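(* M-CLP is strictly feasible at $T$ if and only if Test-LP is strictly feasible at $T$.
   Context: Let $T>0$, $A$ a constant $K\times J$ matrix, $\beta,b\in\mathbb R^K$, $\gamma,c\in\mathbb R^J$ constant vectors. Superscript $T$ on vectors is transpose; vector inequalities are componentwise, and "vector $\ge\alpha$" for a scalar $\alpha$ means every component is $\ge\alpha$. M-CLP: maximize $\int_{0-}^T(\gamma+(T-t)c)^{T}dU(t)$ subject to $AU(t)\le\beta+bt$ for $0\le t\le T$, where $U:[0,T]\to\mathbb R^J$ is non-negative, non-decreasing and right-continuous (Lebesgue–Stieltjes integral, convention $U(0-)=0$). M-CLP is strictly feasible at $T$ if there exist a feasible solution $U(t)$ and a constant $\alpha>0$ such that $\beta+bt-AU(t)\ge\alpha$ for all $t\in[0,T]$. Test-LP is the linear program in $\mathbf u,U\in\mathbb R^J$: $$\max\ (\gamma+cT)^{T}\mathbf u+\gamma^{T}U\quad\text{s.t. } A\mathbf u\le\beta,\quad A\mathbf u+AU\le\beta+bT,\quad \mathbf u,U\ge 0.$$ Test-LP is strictly feasible at $T$ if there exist a feasible solution $\mathbf u,U$ and a constant $\alpha>0$ such that $\beta-A\mathbf u\ge\alpha$ and $\beta+bT-A\mathbf u-AU\ge\alpha$. *)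

theory Defs
  imports "HOL-Analysis.Analysis"
begin

text \<open>
  Vectors are ordered componentwise by the library order on \<open>real ^ 'n\<close>, and
  \<open>vec \<alpha>\<close> is the vector all of whose components are \<open>\<alpha>\<close>.
  Feasibility involves only the constraints of the two problems, so the objective
  coefficients \<open>\<gamma>\<close> and \<open>c\<close> do not occur.
\<close>

text \<open>
  A control is a total function of which only the values on \<open>[0, T]\<close> are constrained.
  Right-continuity at \<open>T\<close> is vacuous for a function on \<open>[0, T]\<close>. Since \<open>U(0-) = 0\<close>,
  a jump \<open>U 0 \<ge> 0\<close> at the origin is allowed.
\<close>

definition mclp_feasible ::
  "real \<Rightarrow> real ^ 'j ^ 'k \<Rightarrow> real ^ 'k \<Rightarrow> real ^ 'k \<Rightarrow> (real \<Rightarrow> real ^ 'j) \<Rightarrow> bool"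
  where "mclp_feasible T A \<beta> b U \<longleftrightarrow>
    (\<forall>t\<in>{0..T}. 0 \<le> U t) \<and>
    mono_on {0..T} U \<and>
    (\<forall>t\<in>{0..<T}. continuous (at_right t) U) \<and>
    (\<forall>t\<in>{0..T}. A *v U t \<le> \<beta> + t *\<^sub>R b)"

definition mclp_strictly_feasible ::
  "real \<Rightarrow> real ^ 'j ^ 'k \<Rightarrow> real ^ 'k \<Rightarrow> real ^ 'k \<Rightarrow> bool"
  where "mclp_strictly_feasible T A \<beta> b \<longleftrightarrow>
    (\<exists>U \<alpha>. mclp_feasible T A \<beta> b U \<and> \<alpha> > 0 \<and>
      (\<forall>t\<in>{0..T}. \<beta> + t *\<^sub>R b - A *v U t \<ge> vec \<alpha>))"

definition test_lp_feasible ::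
  "real \<Rightarrow> real ^ 'j ^ 'k \<Rightarrow> real ^ 'k \<Rightarrow> real ^ 'k \<Rightarrow> real ^ 'j \<Rightarrow> real ^ 'j \<Rightarrow> bool"
  where "test_lp_feasible T A \<beta> b u U \<longleftrightarrow>
    A *v u \<le> \<beta> \<and>
    A *v u + A *v U \<le> \<beta> + T *\<^sub>R b \<and>
    0 \<le> u \<and> 0 \<le> U"

definition test_lp_strictly_feasible ::
  "real \<Rightarrow> real ^ 'j ^ 'k \<Rightarrow> real ^ 'k \<Rightarrow> real ^ 'k \<Rightarrow> bool"
  where "test_lp_strictly_feasible T A \<beta> b \<longleftrightarrow>
    (\<exists>u U \<alpha>. test_lp_feasible T A \<beta> b u U \<and> \<alpha> > 0 \<and>
      \<beta> - A *v u \<ge> vec \<alpha> \<and>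
      \<beta> + T *\<^sub>R b - A *v u - A *v U \<ge> vec \<alpha>)"

end

theory Submission
  imports Defs
begin

text \<open>
  The constraint slack \<open>\<beta> + t b - A U(t)\<close> is affine in the pair \<open>(t, U(t))\<close>. A strictly feasible
  control therefore only has to be looked at in its two end points: its initial jump \<open>U(0)\<close> and
  its total later increment \<open>U(T) - U(0)\<close>, which is non-negative by monotonicity, have at times
  \<open>0\<close> and \<open>T\<close> exactly the two slacks that the linear program bounds. Conversely, from a jump \<open>u\<close>
  and an increment \<open>V\<close>, the control that jumps by \<open>u\<close> at \<open>0\<close> and then grows at the constant rate
  \<open>V / T\<close> has at time \<open>t\<close> the convex combination, with weight \<open>t / T\<close>, of these two slacks, so
  the same \<open>\<alpha>\<close> bounds it on the whole interval.
\<close>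

lemma convex_combination_ge:
  fixes a x y :: "'a :: ordered_real_vector"
  assumes "a \<le> x" "a \<le> y" "0 \<le> s" "s \<le> 1"
  shows "a \<le> (1 - s) *\<^sub>R x + s *\<^sub>R y"
proof -
  have "(1 - s) *\<^sub>R a + s *\<^sub>R a \<le> (1 - s) *\<^sub>R x + s *\<^sub>R y"
    using assms by (intro add_mono scaleR_left_mono) auto
  then show ?thesis
    by (simp add: algebra_simps)
qed

lemma le_if_slack_ge_vec:
  fixes x y :: "real ^ 'n"
  assumes "vec \<alpha> \<le> y - x" "0 \<le> \<alpha>"
  shows "x \<le> y"
  unfolding less_eq_vec_def
proof
  fix i
  have "\<alpha> \<le> y $ i - x $ i"
    using assms(1) by (simp add: less_eq_vec_def)
  with assms(2) show "x $ i \<le> y $ i" by linarith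
qed

lemma slack_of_constant_rate_control:
  fixes A :: "real ^ 'j ^ 'k" and \<beta> b :: "real ^ 'k"
  assumes "T \<noteq> 0"
  shows "\<beta> + t *\<^sub>R b - A *v (u + (t / T) *\<^sub>R V) =
    (1 - t / T) *\<^sub>R (\<beta> - A *v u) + (t / T) *\<^sub>R (\<beta> + T *\<^sub>R b - A *v u - A *v V)"
proof -
  have "t *\<^sub>R b = (t / T) *\<^sub>R T *\<^sub>R b"
    using assms by simp
  moreover have "A *v (u + (t / T) *\<^sub>R V) = A *v u + (t / T) *\<^sub>R (A *v V)"
    by (simp add: matrix_vector_right_distrib matrix_vector_mult_scaleR)
  ultimately show ?thesis
    by (simp only: algebra_simps scaleR_one)
qed

lemma mclp_strictly_feasible_imp_test_lp:
  assumes "T > 0" "mclp_strictly_feasible T A \<beta> b"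
  shows "test_lp_strictly_feasible T A \<beta> b"
proof -
  obtain U \<alpha> where feas: "mclp_feasible T A \<beta> b U" and "\<alpha> > 0"
    and slack: "\<And>t. t \<in> {0..T} \<Longrightarrow> vec \<alpha> \<le> \<beta> + t *\<^sub>R b - A *v U t"
    using assms(2) unfolding mclp_strictly_feasible_def by blast
  have ends: "0 \<in> {0..T}" "T \<in> {0..T}"
    using assms(1) by auto
  have "U 0 \<le> U T"
    using feas ends assms(1) unfolding mclp_feasible_def by (blast intro: mono_onD less_imp_le)
  moreover have total: "A *v U 0 + A *v (U T - U 0) = A *v U T"
    by (simp add: matrix_vector_mult_diff_distrib)
  moreover have "0 \<le> U 0" "A *v U 0 \<le> \<beta>" "A *v U T \<le> \<beta> + T *\<^sub>R b"
    using feas ends unfolding mclp_feasible_def by force+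
  ultimately have "test_lp_feasible T A \<beta> b (U 0) (U T - U 0)"
    by (simp add: test_lp_feasible_def)
  moreover have "vec \<alpha> \<le> \<beta> - A *v U 0"
    using slack[OF ends(1)] by simp
  moreover have "vec \<alpha> \<le> \<beta> + T *\<^sub>R b - A *v U 0 - A *v (U T - U 0)"
    using slack[OF ends(2)] by (simp only: diff_diff_eq total)
  ultimately show ?thesis
    using \<open>\<alpha> > 0\<close> unfolding test_lp_strictly_feasible_def by blast
qed

lemma test_lp_strictly_feasible_imp_mclp:
  assumes "T > 0" "test_lp_strictly_feasible T A \<beta> b"
  shows "mclp_strictly_feasible T A \<beta> b"
proof -
  obtain u V \<alpha> where "0 \<le> u" "0 \<le> V" "\<alpha> > 0"
    and slack: "vec \<alpha> \<le> \<beta> - A *v u" "vec \<alpha> \<le> \<beta> + T *\<^sub>R b - A *v u - A *v V"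
    using assms(2) unfolding test_lp_strictly_feasible_def test_lp_feasible_def by blast
  define U where "U t = u + (t / T) *\<^sub>R V" for t
  have slack_U: "vec \<alpha> \<le> \<beta> + t *\<^sub>R b - A *v U t" if "t \<in> {0..T}" for t
    unfolding U_def using assms(1) that slack
    by (subst slack_of_constant_rate_control) (auto intro!: convex_combination_ge)
  have "mclp_feasible T A \<beta> b U"
    unfolding mclp_feasible_def
  proof (intro conjI ballI)
    show "0 \<le> U t" if "t \<in> {0..T}" for t
      using that \<open>0 \<le> u\<close> \<open>0 \<le> V\<close> by (auto simp: U_def intro!: add_nonneg_nonneg scaleR_nonneg_nonneg)
    show "mono_on {0..T} U"
      using assms(1) \<open>0 \<le> V\<close>
      by (auto simp: U_def intro!: mono_onI scaleR_right_mono divide_right_mono)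
    show "continuous (at_right t) U" for t
      unfolding U_def by (intro continuous_intros) (use assms(1) in auto)
    show "A *v U t \<le> \<beta> + t *\<^sub>R b" if "t \<in> {0..T}" for t
      using le_if_slack_ge_vec[OF slack_U[OF that]] \<open>\<alpha> > 0\<close> by simp
  qed
  then show ?thesis
    using slack_U \<open>\<alpha> > 0\<close> unfolding mclp_strictly_feasible_def by blast
qed

theorem corollary3p4:
  fixes T :: real
    and A :: "real ^ 'j ^ 'k"
    and \<beta> b :: "real ^ 'k"
  assumes "T > 0"
  shows "mclp_strictly_feasible T A \<beta> b \<longleftrightarrow> test_lp_strictly_feasible T A \<beta> b"
  using assms mclp_strictly_feasible_imp_test_lp test_lp_strictly_feasible_imp_mclp by blast

end
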